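(* Let $\varphi:\mathbb{R}^2\to\mathbb{R}^2$ be such that $\varphi(x_1,x_2)=(\varphi_1(x_1,x_2),\varphi_2(x_1,x_2))$ for some bivariate, real-valued functions $\varphi_1$ and $\varphi_2$. Assume additionally that (a) all second-order mixed partial derivatives of $\varphi_1,\varphi_2$ are continuous, (b) $J_\varphi(x_1,x_2)$ is an upper-triangular matrix, (c) $\det J_\varphi(x_1,x_2)=1$. Then $$\varphi(x_1,x_2)=\left(z(x_2)x_1+f(x_2),\;\int_1^{x_2}\frac{1}{z(t)}\,dt+K\right)$$ for some constant $K$ and some functions $z,f\in C^1(\mathbb{R})$. Moreover, if $z$ is taken to be the constant function $1$, then $\varphi$ is necessarily of the form $\varphi(x_1,x_2)=(x_1+l_1(x_2),x_2)$ for some $C^1$ function $l_1$, and $E(\mathbb{Z}^2,\varphi)$ is an orthonormal basis for $L^2([0,1]^2)$.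
   Context: $J_\varphi=(\partial\varphi_i/\partial x_j)_{i,j=1,2}$ denotes the Jacobian matrix of $\varphi$; conditions (b) and (c) are understood at every point $(x_1,x_2)\in\mathbb{R}^2$. $E(\mathbb{Z}^2,\varphi)=\{e^{2\pi i k\cdot\varphi(x)}:k\in\mathbb{Z}^2\}$, regarded as functions of $x\in[0,1]^2$, and $L^2([0,1]^2)$ is taken with respect to Lebesgue measure.
   Formalization: For z=1 the second component is proved to be x_2+(K-1), equal to x_2 when K=1, since φ=(x_1,x_2+5) refutes the stated form; first-order partials are also assumed continuous, without which f need not be C^1. *)

theory Defs
  imports "HOL-Analysis.Analysis"
begin

definition partial_deriv :: "'n::finite \<Rightarrow> (real^'n \<Rightarrow> real) \<Rightarrow> real^'n \<Rightarrow> real" where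
  "partial_deriv j g x = deriv (\<lambda>t. g (x + t *\<^sub>R axis j 1)) 0"

definition continuously_partial_diff :: "'n::finite \<Rightarrow> (real^'n \<Rightarrow> real) \<Rightarrow> bool" where
  "continuously_partial_diff j g \<longleftrightarrow>
     (\<forall>x. (\<lambda>t. g (x + t *\<^sub>R axis j 1)) field_differentiable (at 0)) \<and>
     continuous_on UNIV (partial_deriv j g)"

(* Continuity of the mixed second-order partials alone does not imply continuity of the
   first-order ones (consider g x = h (x $ 2) with h differentiable but not C^1), so the latter
   is part of the definition. The pure second-order partials are not required to exist; in
   particular every C^2 function satisfies this predicate. *)
definition continuous_mixed_partials :: "(real^'n::finite \<Rightarrow> real) \<Rightarrow> bool" where
  "continuous_mixed_partials g \<longleftrightarrow>
     (\<forall>j. continuously_partial_diff j g) \<and>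
     (\<forall>j k. j \<noteq> k \<longrightarrow> continuously_partial_diff k (partial_deriv j g))"

definition jacobi_matrix :: "(real^'n::finite \<Rightarrow> real^'m::finite) \<Rightarrow> real^'n \<Rightarrow> real^'n^'m" where
  "jacobi_matrix \<phi> x = (\<chi> i j. partial_deriv j (\<lambda>y. \<phi> y $ i) x)"

(* Not expressed through the order of the index type 2: there 2 = 0 < 1. *)
definition upper_triangular2 :: "real^2^2 \<Rightarrow> bool" where
  "upper_triangular2 A \<longleftrightarrow> A $ 2 $ 1 = 0"

(* The interval integral is oriented, so the second component is also right for x $ 2 < 1.
   The condition on zeros of z makes the integrand 1 / z meaningful. *)
definition triangular_form ::
    "(real^2 \<Rightarrow> real^2) \<Rightarrow> (real \<Rightarrow> real) \<Rightarrow> (real \<Rightarrow> real) \<Rightarrow> real \<Rightarrow> bool" where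
  "triangular_form \<phi> z f K \<longleftrightarrow>
     z C1_differentiable_on UNIV \<and> f C1_differentiable_on UNIV \<and> (\<forall>t. z t \<noteq> 0) \<and>
     (\<forall>x. \<phi> x = vector [z (x $ 2) * x $ 1 + f (x $ 2), (LBINT t=1..x $ 2. 1 / z t) + K])"

text \<open>Square-integrable functions are not identified when they agree almost everywhere. Two distinct
  such functions in a set \<open>B\<close> that agree almost everywhere violate orthonormality below, so
  \<open>orthonormal_basis_L2 M B\<close> entails the corresponding property of the equivalence classes.\<close>

definition L2_functions :: "'a measure \<Rightarrow> ('a \<Rightarrow> complex) set" where
  "L2_functions M = {f \<in> borel_measurable M. integrable M (\<lambda>x. (cmod (f x))\<^sup>2)}"

definition L2_inner :: "'a measure \<Rightarrow> ('a \<Rightarrow> complex) \<Rightarrow> ('a \<Rightarrow> complex) \<Rightarrow> complex" where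
  "L2_inner M f g = (LINT x|M. f x * cnj (g x))"

definition L2_norm_fun :: "'a measure \<Rightarrow> ('a \<Rightarrow> complex) \<Rightarrow> real" where
  "L2_norm_fun M f = sqrt (LINT x|M. (cmod (f x))\<^sup>2)"

definition orthonormal_basis_L2 :: "'a measure \<Rightarrow> ('a \<Rightarrow> complex) set \<Rightarrow> bool" where
  "orthonormal_basis_L2 M B \<longleftrightarrow>
     B \<subseteq> L2_functions M \<and>
     (\<forall>g\<in>B. \<forall>h\<in>B. L2_inner M g h = (if g = h then 1 else 0)) \<and>
     (\<forall>f\<in>L2_functions M. \<forall>\<epsilon>>0. \<exists>S c. finite S \<and> S \<subseteq> B \<and>
        L2_norm_fun M (\<lambda>x. f x - (\<Sum>g\<in>S. c g * g x)) < \<epsilon>)"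

definition exponential_system :: "(real^2 \<Rightarrow> real^2) \<Rightarrow> (real^2 \<Rightarrow> complex) set" where
  "exponential_system \<phi> =
     range (\<lambda>k::int^2. \<lambda>x. exp (2 * of_real pi * \<i> * of_real ((\<chi> i. of_int (k $ i)) \<bullet> \<phi> x)))"

end

theory Submission
  imports Defs
begin

text \<open>
  \<^bold>\<open>The triangular form.\<close> Upper triangularity says that the second component of \<open>\<phi>\<close> is a function of
  \<open>x $ 2\<close> alone, and the determinant condition makes the derivative of the first component in the
  direction of \<open>x $ 1\<close> the reciprocal of the derivative of that function. The first component is
  therefore affine in \<open>x $ 1\<close>, and integrating the derivative of the second component gives the formula
  (\<open>triangular_form_exists\<close>).

  \<^bold>\<open>The basis.\<close> If \<open>z = 1\<close>, then \<open>\<phi>\<close> is a shear followed by a translation, and the claim is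
  \<open>orthonormal_basis_L2_shear\<close>. An exponential of nonzero frequency is multiplied by \<open>-1\<close> under a
  suitable shift in one coordinate direction in which it has period 1, and such shifts preserve
  integrals over the unit square, so its integral vanishes (\<open>integral_unit_cube_eq_0\<close>). This is the
  orthogonality.

  For completeness, the exponentials of \<open>\<phi>\<close> are the monomials in the components, and their conjugates,
  of the map \<open>\<Psi>\<close> from the square to the torus given by \<open>\<phi>\<close> modulo integer vectors. This map identifies
  points of the boundary of the square only. It suffices to approximate continuous functions that
  vanish on the boundary, as these are dense in \<open>L\<^sup>2\<close> (\<open>L2_approximable_cbox\<close>). They descend to
  continuous functions on the compact image of \<open>\<Psi>\<close>, where the Stone-Weierstrass theorem approximates
  them uniformly by polynomials, that is, by combinations of exponentials
  (\<open>Stone_Weierstrass_lin_combs\<close>).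
\<close>

section \<open>Approximation in the square mean\<close>

text \<open>The error is measured by the squared norm, so that no square roots appear; the inequality
  \<open>norm_diff_power2_le\<close> then takes the place of the triangle inequality.\<close>

definition L2_approximable :: "'a measure \<Rightarrow> ('a \<Rightarrow> complex) set \<Rightarrow> ('a \<Rightarrow> complex) \<Rightarrow> bool" where
  "L2_approximable M A f \<longleftrightarrow> (\<forall>\<epsilon>>0. \<exists>u\<in>A. (LINT x|M. (cmod (f x - u x))\<^sup>2) < \<epsilon>)"

lemma norm_diff_power2_le:
  fixes a b :: "'a::real_normed_vector"
  shows "(norm (a - b))\<^sup>2 \<le> 2 * (norm a)\<^sup>2 + 2 * (norm b)\<^sup>2"
proof -
  have "(norm (a - b))\<^sup>2 \<le> (norm a + norm b)\<^sup>2"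
    by (intro power_mono norm_triangle_ineq4) auto
  also have "\<dots> \<le> 2 * (norm a)\<^sup>2 + 2 * (norm b)\<^sup>2"
    using sum_squares_bound[of "norm a" "norm b"] by (simp add: power2_sum)
  finally show ?thesis .
qed

lemma L2_functions_diff:
  assumes "f \<in> L2_functions M" "g \<in> L2_functions M"
  shows "(\<lambda>x. f x - g x) \<in> L2_functions M"
proof -
  have [measurable]: "f \<in> borel_measurable M" "g \<in> borel_measurable M"
    and "integrable M (\<lambda>x. (cmod (f x))\<^sup>2)" "integrable M (\<lambda>x. (cmod (g x))\<^sup>2)"
    using assms by (auto simp: L2_functions_def)
  then have "integrable M (\<lambda>x. 2 * (cmod (f x))\<^sup>2 + 2 * (cmod (g x))\<^sup>2)"
    by auto
  then have "integrable M (\<lambda>x. (cmod (f x - g x))\<^sup>2)"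
    by (rule Bochner_Integration.integrable_bound)
      (use norm_diff_power2_le[of "f _" "g _"] in auto)
  then show ?thesis
    by (simp add: L2_functions_def)
qed

lemma L2_approximable_trans:
  assumes A: "A \<subseteq> L2_functions M" and f: "f \<in> L2_functions M"
    and near: "\<And>\<epsilon>. 0 < \<epsilon> \<Longrightarrow> \<exists>h\<in>L2_functions M. (LINT x|M. (cmod (f x - h x))\<^sup>2) < \<epsilon> \<and> L2_approximable M A h"
  shows "L2_approximable M A f"
  unfolding L2_approximable_def
proof (intro allI impI)
  fix \<epsilon> :: real assume "0 < \<epsilon>"
  then have \<epsilon>4: "0 < \<epsilon> / 4" by simp
  obtain h where h: "h \<in> L2_functions M" "(LINT x|M. (cmod (f x - h x))\<^sup>2) < \<epsilon> / 4"
      "L2_approximable M A h"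
    using near[OF \<epsilon>4] by blast
  obtain u where u: "u \<in> A" "(LINT x|M. (cmod (h x - u x))\<^sup>2) < \<epsilon> / 4"
    using h(3) \<epsilon>4 unfolding L2_approximable_def by blast
  have uL: "u \<in> L2_functions M" using u A by blast
  have I: "integrable M (\<lambda>x. (cmod (f x - h x))\<^sup>2)" "integrable M (\<lambda>x. (cmod (h x - u x))\<^sup>2)"
    "integrable M (\<lambda>x. (cmod (f x - u x))\<^sup>2)"
    using L2_functions_diff[OF f h(1)] L2_functions_diff[OF h(1) uL] L2_functions_diff[OF f uL]
    by (auto simp: L2_functions_def)
  have "(LINT x|M. (cmod (f x - u x))\<^sup>2) \<le>
      (LINT x|M. 2 * (cmod (f x - h x))\<^sup>2 + 2 * (cmod (h x - u x))\<^sup>2)"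
  proof (intro integral_mono I)
    show "integrable M (\<lambda>x. 2 * (cmod (f x - h x))\<^sup>2 + 2 * (cmod (h x - u x))\<^sup>2)"
      using I by auto
    show "(cmod (f x - u x))\<^sup>2 \<le> 2 * (cmod (f x - h x))\<^sup>2 + 2 * (cmod (h x - u x))\<^sup>2" for x
      using norm_diff_power2_le[of "f x - h x" "u x - h x"] by (simp add: norm_minus_commute)
  qed
  also have "\<dots> = 2 * (LINT x|M. (cmod (f x - h x))\<^sup>2) + 2 * (LINT x|M. (cmod (h x - u x))\<^sup>2)"
    using I by simp
  also have "\<dots> < \<epsilon>" using h(2) u(2) by linarith
  finally show "\<exists>u\<in>A. (LINT x|M. (cmod (f x - u x))\<^sup>2) < \<epsilon>" using u(1) by blast
qed

text \<open>The set of approximable functions is closed under dominated almost everywhere convergence, because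
  dominated convergence makes the squared distances to the limit tend to zero. Truncation, passage to
  continuous functions and cutting off near the boundary are all instances of this.\<close>

lemma L2_approximable_limit:
  fixes w :: "'a \<Rightarrow> real"
  assumes A: "A \<subseteq> L2_functions M"
    and f: "f \<in> borel_measurable M" and h: "\<And>n. h n \<in> borel_measurable M"
    and lim: "AE x in M. (\<lambda>n. h n x) \<longlonglongrightarrow> f x"
    and le: "\<And>n x. cmod (h n x) \<le> w x" "\<And>x. cmod (f x) \<le> w x"
    and w: "integrable M (\<lambda>x. (w x)\<^sup>2)"
    and app: "\<And>n::nat. L2_approximable M A (h n)"
  shows "L2_approximable M A f"
proof (rule L2_approximable_trans[OF A])
  have L2: "v \<in> L2_functions M" if "v \<in> borel_measurable M" "\<And>x. cmod (v x) \<le> w x" for v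
  proof -
    have "integrable M (\<lambda>x. (cmod (v x))\<^sup>2)"
      by (rule Bochner_Integration.integrable_bound[OF w])
        (use that in \<open>auto intro!: AE_I2 power_mono\<close>)
    with that show ?thesis by (simp add: L2_functions_def)
  qed
  show "f \<in> L2_functions M" using L2 f le by blast
  have "(\<lambda>n. LINT x|M. (cmod (f x - h n x))\<^sup>2) \<longlonglongrightarrow> (LINT x|M. 0)"
  proof (rule integral_dominated_convergence)
    show "integrable M (\<lambda>x. 4 * (w x)\<^sup>2)" using w by auto
    show "AE x in M. (\<lambda>n. (cmod (f x - h n x))\<^sup>2) \<longlonglongrightarrow> 0"
      using lim
    proof (eventually_elim)
      case (elim x)
      have "(\<lambda>n. (cmod (f x - h n x))\<^sup>2) \<longlonglongrightarrow> (cmod (f x - f x))\<^sup>2"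
        by (intro tendsto_intros elim)
      then show ?case by simp
    qed
    show "AE x in M. norm ((cmod (f x - h n x))\<^sup>2) \<le> 4 * (w x)\<^sup>2" for n
    proof (rule AE_I2)
      fix x
      have "(cmod (f x))\<^sup>2 \<le> (w x)\<^sup>2" "(cmod (h n x))\<^sup>2 \<le> (w x)\<^sup>2"
        by (auto intro!: power_mono le)
      then show "norm ((cmod (f x - h n x))\<^sup>2) \<le> 4 * (w x)\<^sup>2"
        using norm_diff_power2_le[of "f x" "h n x"] by simp
    qed
  qed (use f h in auto)
  then have *: "(\<lambda>n. LINT x|M. (cmod (f x - h n x))\<^sup>2) \<longlonglongrightarrow> 0" by simp
  show "\<exists>h\<in>L2_functions M. (LINT x|M. (cmod (f x - h x))\<^sup>2) < \<epsilon> \<and> L2_approximable M A h"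
    if \<epsilon>: "0 < \<epsilon>" for \<epsilon>
  proof -
    obtain n where "(LINT x|M. (cmod (f x - h n x))\<^sup>2) < \<epsilon>"
      using order_tendstoD(2)[OF * \<epsilon>] by (auto dest: eventually_happens)
    then show ?thesis using app L2[OF h le(1)] by blast
  qed
qed

section \<open>Reduction to continuous functions that vanish on the boundary\<close>

text \<open>A measurable function is almost everywhere the limit of continuous functions. Composing these with
  the nearest-point map onto the disc of radius \<open>B\<close> keeps them continuous, bounds them, and does not
  change the limit, whose values already lie in the disc. The factors \<open>min 1 (n * d x)\<close>, with \<open>d\<close> the
  distance to the complement of the open box, make them vanish outside that box and tend to 1
  inside it, hence almost everywhere in the closed box.\<close>

lemma L2_approximable_bounded_cbox:
  fixes A :: "('a::euclidean_space \<Rightarrow> complex) set"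
  assumes A: "A \<subseteq> L2_functions (lebesgue_on (cbox a b))"
    and cont: "\<And>h. continuous_on UNIV h \<Longrightarrow> (\<And>x. x \<notin> box a b \<Longrightarrow> h x = 0) \<Longrightarrow>
        L2_approximable (lebesgue_on (cbox a b)) A h"
    and f: "f \<in> borel_measurable (lebesgue_on (cbox a b))" and B: "\<And>x. cmod (f x) \<le> B"
  shows "L2_approximable (lebesgue_on (cbox a b)) A f"
proof -
  let ?M = "lebesgue_on (cbox a b)"
  have "0 \<le> B" using B[of undefined] norm_ge_zero order_trans by blast
  have "f measurable_on cbox a b"
    using f by (simp add: measurable_on_iff_borel_measurable)
  then obtain N g where N: "negligible N" and g: "\<And>n::nat. continuous_on UNIV (g n)"
    and lim: "\<And>x. x \<notin> N \<Longrightarrow> (\<lambda>n. g n x) \<longlonglongrightarrow> (if x \<in> cbox a b then f x else 0)"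
    unfolding measurable_on_def by blast
  define P where "P = closest_point (cball (0::complex) B)"
  have P: "continuous_on UNIV P" "\<And>z. cmod z \<le> B \<Longrightarrow> P z = z" "\<And>z. cmod (P z) \<le> B"
  proof -
    show "continuous_on UNIV P"
      unfolding P_def using \<open>0 \<le> B\<close> by (intro continuous_on_closest_point) auto
    show "P z = z" if "cmod z \<le> B" for z
      unfolding P_def using that by (intro closest_point_self) auto
    show "cmod (P z) \<le> B" for z
      using closest_point_in_set[of "cball (0::complex) B" z] \<open>0 \<le> B\<close> by (auto simp: P_def)
  qed
  define d where "d x = infdist x (- box a b)" for x
  have ne: "- box a b \<noteq> {}"
    using bounded_box[of a b] not_bounded_UNIV by (metis double_compl Compl_empty_eq)
  have d0: "d x = 0" if "x \<notin> box a b" for x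
    using that by (simp add: d_def)
  have dpos: "0 < d x" if "x \<in> box a b" for x
    using in_closed_iff_infdist_zero[of "- box a b" x] ne that infdist_nonneg[of x "- box a b"]
    by (auto simp: d_def closed_Compl open_box less_le)
  define h where "h n x = complex_of_real (min 1 (real n * d x)) * P (g n x)" for n x
  show ?thesis
  proof (rule L2_approximable_limit[OF A f, where h = h and w = "\<lambda>_. B"])
    have hc: "continuous_on UNIV (h n)" for n
      unfolding h_def d_def
      by (intro continuous_intros continuous_on_compose2[OF P(1)] g) auto
    show "h n \<in> borel_measurable ?M" for n
      by (intro continuous_imp_measurable_on_sets_lebesgue continuous_on_subset[OF hc]) auto
    show "L2_approximable ?M A (h n)" for n
      by (rule cont[OF hc]) (simp add: h_def d0)
    show "cmod (h n x) \<le> B" for n x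
    proof -
      have "0 \<le> real n * d x" by (simp add: d_def infdist_nonneg)
      then have "\<bar>min 1 (real n * d x)\<bar> \<le> 1" by linarith
      then have "cmod (h n x) \<le> 1 * B"
        unfolding h_def norm_mult norm_of_real by (intro mult_mono P) auto
      then show ?thesis by simp
    qed
    show "integrable ?M (\<lambda>_. B\<^sup>2)"
      by (simp add: continuous_imp_integrable)
    have "negligible (N \<union> (cbox a b - box a b))"
      using N by (auto intro: negligible_Un simp: negligible_frontier_interval)
    then have "N \<union> (cbox a b - box a b) \<in> null_sets lebesgue"
      by (simp add: negligible_iff_null_sets)
    then have "AE x in lebesgue. x \<notin> N \<union> (cbox a b - box a b)"
      by (rule AE_not_in)
    then have "AE x in lebesgue. x \<in> cbox a b \<longrightarrow> x \<notin> N \<union> (cbox a b - box a b)"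
      by eventually_elim auto
    then have "AE x in ?M. x \<notin> N \<union> (cbox a b - box a b)"
      by (subst AE_restrict_space_iff) auto
    moreover have "AE x in ?M. x \<in> cbox a b"
      by (rule AE_I2) auto
    ultimately show "AE x in ?M. (\<lambda>n. h n x) \<longlonglongrightarrow> f x"
    proof eventually_elim
      case (elim x)
      then have x: "x \<in> box a b" "x \<notin> N" by auto
      have "(\<lambda>n. P (g n x)) \<longlonglongrightarrow> P (f x)"
        using lim[OF x(2)] elim(2) P(1)
        by (auto intro!: isCont_tendsto_compose[of _ P] simp: continuous_on_eq_continuous_at)
      then have 1: "(\<lambda>n. P (g n x)) \<longlonglongrightarrow> f x"
        using P(2) B by simp
      have "eventually (\<lambda>n. 1 \<le> real n * d x) sequentially"
      proof -
        obtain m where "1 / d x \<le> real m" using real_arch_simple by blast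
        then have "1 \<le> real m * d x"
          using dpos[OF x(1)] by (simp add: divide_le_eq)
        then have "1 \<le> real n * d x" if "n \<ge> m" for n
          by (rule order_trans) (use that dpos[OF x(1)] in \<open>auto intro!: mult_right_mono\<close>)
        then show ?thesis unfolding eventually_sequentially by blast
      qed
      then have "eventually (\<lambda>n. P (g n x) = h n x) sequentially"
        by eventually_elim (simp add: h_def)
      then show ?case using 1 by (rule Lim_transform_eventually[rotated])
    qed
  qed (use B in auto)
qed

text \<open>Cutting an \<open>L\<^sup>2\<close> function to zero where it exceeds \<open>n\<close> reduces the claim to bounded functions,
  with the function itself as the dominating function.\<close>

lemma L2_approximable_cbox:
  fixes A :: "('a::euclidean_space \<Rightarrow> complex) set"
  assumes A: "A \<subseteq> L2_functions (lebesgue_on (cbox a b))"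
    and cont: "\<And>h. continuous_on UNIV h \<Longrightarrow> (\<And>x. x \<notin> box a b \<Longrightarrow> h x = 0) \<Longrightarrow>
        L2_approximable (lebesgue_on (cbox a b)) A h"
    and f: "f \<in> L2_functions (lebesgue_on (cbox a b))"
  shows "L2_approximable (lebesgue_on (cbox a b)) A f"
proof (rule L2_approximable_limit[OF A])
  let ?M = "lebesgue_on (cbox a b)"
  define h where "h n x = (if cmod (f x) \<le> real n then f x else 0)" for n x
  show fm[measurable]: "f \<in> borel_measurable ?M" and "integrable ?M (\<lambda>x. (cmod (f x))\<^sup>2)"
    using f by (auto simp: L2_functions_def)
  show hm: "h n \<in> borel_measurable ?M" for n
    unfolding h_def by measurable
  show "L2_approximable ?M A (h n)" for n
    by (rule L2_approximable_bounded_cbox[OF A cont hm, where B = "real n"]) (auto simp: h_def)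
  show "AE x in ?M. (\<lambda>n. h n x) \<longlonglongrightarrow> f x"
  proof (rule AE_I2)
    fix x
    obtain m where m: "cmod (f x) \<le> real m" using real_arch_simple by blast
    then have "f x = h n x" if "n \<ge> m" for n
      using that unfolding h_def by (smt (verit) of_nat_mono)
    then have "eventually (\<lambda>n. f x = h n x) sequentially"
      unfolding eventually_sequentially by blast
    then show "(\<lambda>n. h n x) \<longlonglongrightarrow> f x"
      by (rule Lim_transform_eventually[OF tendsto_const])
  qed
qed (auto simp: if_distrib)

lemma continuous_imp_L2_functions:
  fixes h :: "'a::euclidean_space \<Rightarrow> complex"
  assumes "continuous_on (cbox a b) h"
  shows "h \<in> L2_functions (lebesgue_on (cbox a b))"
  using assms unfolding L2_functions_def
  by (auto intro!: continuous_imp_measurable_on_sets_lebesgue continuous_imp_integrable continuous_intros)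

lemma L2_approximable_uniform:
  fixes h :: "'a::euclidean_space \<Rightarrow> complex"
  assumes A: "A \<subseteq> L2_functions (lebesgue_on (cbox a b))" and h: "continuous_on (cbox a b) h"
    and unif: "\<And>e. 0 < e \<Longrightarrow> \<exists>u\<in>A. \<forall>x\<in>cbox a b. cmod (h x - u x) < e"
  shows "L2_approximable (lebesgue_on (cbox a b)) A h"
  unfolding L2_approximable_def
proof (intro allI impI)
  fix \<epsilon> :: real assume "0 < \<epsilon>"
  let ?M = "lebesgue_on (cbox a b)"
  define c where "c = (LINT x|?M. (1::real))"
  have c: "0 \<le> c" by (simp add: c_def)
  \<comment> \<open>With \<open>c\<close> the measure of the box, an error below \<open>e\<close> everywhere gives a squared distance of at
    most \<open>e\<^sup>2 * c\<close>; the denominator \<open>c + 1\<close> also covers a box of measure 0.\<close>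
  define e where "e = sqrt (\<epsilon> / (c + 1))"
  have e: "0 < e" "e\<^sup>2 * c < \<epsilon>"
    using c \<open>0 < \<epsilon>\<close> by (auto simp: e_def field_simps)
  obtain u where u: "u \<in> A" "\<forall>x\<in>cbox a b. cmod (h x - u x) < e"
    using unif[OF e(1)] by blast
  have "(\<lambda>x. h x - u x) \<in> L2_functions ?M"
    using u A by (intro L2_functions_diff continuous_imp_L2_functions[OF h]) auto
  then have "(LINT x|?M. (cmod (h x - u x))\<^sup>2) \<le> (LINT x|?M. e\<^sup>2 * 1)"
    using u(2) by (intro integral_mono)
      (auto simp: L2_functions_def less_imp_le intro!: continuous_imp_integrable power_mono)
  also have "\<dots> = e\<^sup>2 * c" unfolding c_def by (rule integral_mult_right_zero)
  finally show "\<exists>u\<in>A. (LINT x|?M. (cmod (h x - u x))\<^sup>2) < \<epsilon>"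
    using e(2) u(1) by (meson le_less_trans)
qed

section \<open>Linear combinations and the Stone-Weierstrass theorem\<close>

text \<open>Building a combination one term at a time makes the closure properties below plain inductions; the
  form with a finite set of distinct functions is recovered in \<open>lin_combs_imp_sum\<close>.\<close>

inductive_set lin_combs :: "('a \<Rightarrow> complex) set \<Rightarrow> ('a \<Rightarrow> complex) set" for B where
  zero: "(\<lambda>_. 0) \<in> lin_combs B"
| add: "g \<in> B \<Longrightarrow> u \<in> lin_combs B \<Longrightarrow> (\<lambda>x. c * g x + u x) \<in> lin_combs B"

lemma lin_combs_imp_sum:
  assumes "u \<in> lin_combs B"
  shows "\<exists>S c. finite S \<and> S \<subseteq> B \<and> u = (\<lambda>x. \<Sum>g\<in>S. c g * g x)"
  using assms
proof induction
  case zero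
  show ?case by (rule exI[of _ "{}"]) auto
next
  case (add g u a)
  then obtain S c where S: "finite S" "S \<subseteq> B" "u = (\<lambda>x. \<Sum>g\<in>S. c g * g x)" by blast
  define c0 where "c0 = (\<lambda>k. if k \<in> S then c k else 0)"
  have "u x = (\<Sum>k\<in>insert g S. c0 k * k x)" for x
    unfolding S(3) by (rule sum.mono_neutral_cong_left) (use S in \<open>auto simp: c0_def\<close>)
  moreover have "a * g x = (\<Sum>k\<in>insert g S. (if k = g then a else 0) * k x)" for x
    using S(1) by (simp add: if_distrib[of "\<lambda>t. t * _"] sum.delta cong: if_cong)
  ultimately have "a * g x + u x = (\<Sum>k\<in>insert g S. ((if k = g then a else 0) + c0 k) * k x)" for x
    by (simp add: distrib_right sum.distrib)
  then show ?case
    using S \<open>g \<in> B\<close>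
    by (intro exI[of _ "insert g S"] exI[of _ "\<lambda>k. (if k = g then a else 0) + c0 k"]) auto
qed

lemma lin_combs_base: "g \<in> B \<Longrightarrow> (\<lambda>x. c * g x) \<in> lin_combs B"
  using lin_combs.add[OF _ lin_combs.zero] by force

lemma lin_combs_plus:
  assumes "u \<in> lin_combs B" "v \<in> lin_combs B"
  shows "(\<lambda>x. u x + v x) \<in> lin_combs B"
  using assms(1)
proof induction
  case (add g u c)
  then show ?case using lin_combs.add[OF add(1) add(3), of c] by (simp add: add.assoc)
qed (use assms(2) in simp)

lemma lin_combs_scale:
  assumes "u \<in> lin_combs B"
  shows "(\<lambda>x. c * u x) \<in> lin_combs B"
  using assms
proof induction
  case zero
  show ?case using lin_combs.zero by simp
next
  case (add g u a)
  show ?case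
    using lin_combs.add[OF add(1) add(3), of "c * a"] by (simp add: distrib_left mult.assoc)
qed

lemma lin_combs_mult:
  assumes B: "\<And>g h. g \<in> B \<Longrightarrow> h \<in> B \<Longrightarrow> (\<lambda>x. g x * h x) \<in> B"
    and "u \<in> lin_combs B" "v \<in> lin_combs B"
  shows "(\<lambda>x. u x * v x) \<in> lin_combs B"
  using assms(2)
proof induction
  case zero
  show ?case using lin_combs.zero by simp
next
  case (add g u a)
  have "(\<lambda>x. g x * v x) \<in> lin_combs B"
    using assms(3)
  proof induction
    case zero
    show ?case using lin_combs.zero by simp
  next
    case (add h w c)
    show ?case
      using lin_combs.add[OF B[OF \<open>g \<in> B\<close> add(1)] add(3), of c]
      by (simp add: distrib_left mult_ac)
  qed
  from lin_combs_plus[OF lin_combs_scale[OF this, of a] add(3)]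
  show ?case by (simp add: distrib_right mult.assoc)
qed

lemma lin_combs_sum:
  assumes "finite I" "\<And>i. i \<in> I \<Longrightarrow> u i \<in> lin_combs B"
  shows "(\<lambda>x. \<Sum>i\<in>I. u i x) \<in> lin_combs B"
  using assms by (induction I) (auto intro: lin_combs.zero lin_combs_plus)

lemma continuous_on_lin_combs:
  fixes B :: "('a::topological_space \<Rightarrow> complex) set"
  assumes "\<And>g. g \<in> B \<Longrightarrow> continuous_on S g" "u \<in> lin_combs B"
  shows "continuous_on S u"
  using assms(2)
proof induction
  case (add g u c)
  show ?case
    using assms(1)[OF add(1)] add(3) by (intro continuous_on_add continuous_on_mult_left)
qed simp

text \<open>A real linear form in complex variables \<open>w\<^sub>j\<close> is a complex linear combination of the \<open>w\<^sub>j\<close> and their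
  conjugates. So if both of these belong to a set that contains 1 and is closed under products, every real polynomial in
  the \<open>w\<^sub>j\<close> is a combination of members of that set.\<close>

lemma real_polynomial_function_lin_combs:
  fixes \<Psi> :: "'a \<Rightarrow> complex^'m"
  assumes one: "(\<lambda>_. 1) \<in> B" and mult: "\<And>g h. g \<in> B \<Longrightarrow> h \<in> B \<Longrightarrow> (\<lambda>x. g x * h x) \<in> B"
    and coord: "\<And>j. (\<lambda>x. \<Psi> x $ j) \<in> B" and conj: "\<And>j. (\<lambda>x. cnj (\<Psi> x $ j)) \<in> B"
    and p: "real_polynomial_function p"
  shows "(\<lambda>x. complex_of_real (p (\<Psi> x))) \<in> lin_combs B"
  using p
proof induction
  case (linear L)
  have expand: "v = (\<Sum>j\<in>UNIV. Re (v $ j) *\<^sub>R axis j 1 + Im (v $ j) *\<^sub>R axis j \<i>)" for v :: "complex^'m"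
    by (simp add: vec_eq_iff axis_def complex_eq_iff if_distrib sum.distrib cong: if_cong)
  have rep: "complex_of_real (L v) = (\<Sum>j\<in>UNIV.
      (L (axis j 1) / 2 - \<i> * L (axis j \<i>) / 2) * (v $ j) +
      (L (axis j 1) / 2 + \<i> * L (axis j \<i>) / 2) * cnj (v $ j))" for v
  proof -
    interpret bounded_linear L by fact
    have "L v = (\<Sum>j\<in>UNIV. Re (v $ j) * L (axis j 1) + Im (v $ j) * L (axis j \<i>))"
      by (subst expand) (simp add: sum add scaleR)
    moreover have "(L (axis j 1) / 2 - \<i> * L (axis j \<i>) / 2) * (v $ j) +
        (L (axis j 1) / 2 + \<i> * L (axis j \<i>) / 2) * cnj (v $ j) =
        complex_of_real (Re (v $ j) * L (axis j 1) + Im (v $ j) * L (axis j \<i>))" for j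
      by (simp add: complex_eq_iff field_simps)
    ultimately show ?thesis by simp
  qed
  show ?case
    unfolding ext[of "\<lambda>x. complex_of_real (L (\<Psi> x))", OF rep]
    by (intro lin_combs_sum lin_combs_plus lin_combs_base coord conj finite)
next
  case (const c)
  show ?case using lin_combs_base[OF one, of "complex_of_real c"] by simp
next
  case (add f g)
  then show ?case using lin_combs_plus[of _ B] by simp
next
  case (mult f g)
  show ?case
    unfolding of_real_mult by (rule lin_combs_mult[OF _ mult(3) mult(4)]) (rule assms(2))
qed

text \<open>The map \<open>\<Psi>\<close> need not be injective. On a compact set it is a quotient map onto its image, so a
  continuous function that respects the fibres of \<open>\<Psi>\<close> descends to a continuous function on the image,
  which is approximated by polynomials there.\<close>

lemma Stone_Weierstrass_lin_combs:
  fixes \<Psi> :: "'a::t2_space \<Rightarrow> complex^'m" and h :: "'a \<Rightarrow> complex"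
  assumes one: "(\<lambda>_. 1) \<in> B" and mult: "\<And>g h. g \<in> B \<Longrightarrow> h \<in> B \<Longrightarrow> (\<lambda>x. g x * h x) \<in> B"
    and coord: "\<And>j. (\<lambda>x. \<Psi> x $ j) \<in> B" and conj: "\<And>j. (\<lambda>x. cnj (\<Psi> x $ j)) \<in> B"
    and S: "compact S" and \<Psi>: "continuous_on S \<Psi>" and h: "continuous_on S h"
    and fibre: "\<And>x y. x \<in> S \<Longrightarrow> y \<in> S \<Longrightarrow> \<Psi> x = \<Psi> y \<Longrightarrow> h x = h y"
    and e: "0 < e"
  shows "\<exists>u\<in>lin_combs B. \<forall>x\<in>S. cmod (h x - u x) < e"
proof -
  have q: "quotient_map (top_of_set S) (top_of_set (\<Psi> ` S)) \<Psi>"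
    using S \<Psi> by (intro continuous_imp_quotient_map)
      (simp_all add: compact_space_subtopology Hausdorff_space_subtopology image_subset_iff_funcset[symmetric])
  have "\<exists>H. continuous_on (\<Psi> ` S) H \<and> (\<forall>x\<in>S. H (\<Psi> x) = h x)"
  proof (rule quotient_map_lift_exists[OF q])
    show "continuous_map (top_of_set S) euclidean h" using h by simp
    show "h x = h y" if "x \<in> topspace (top_of_set S)" "y \<in> topspace (top_of_set S)" "\<Psi> x = \<Psi> y" for x y
      using that by (intro fibre) simp_all
    show ?thesis if "continuous_map (top_of_set (\<Psi> ` S)) euclidean g"
      "\<And>x. x \<in> topspace (top_of_set S) \<Longrightarrow> g (\<Psi> x) = h x" for g
      using that by (intro exI[of _ g]) simp
  qed
  then obtain H where H: "continuous_on (\<Psi> ` S) H" and H_eq: "\<And>x. x \<in> S \<Longrightarrow> H (\<Psi> x) = h x"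
    by blast
  obtain p where p: "polynomial_function p" "\<And>w. w \<in> \<Psi> ` S \<Longrightarrow> cmod (H w - p w) < e"
    using Stone_Weierstrass_polynomial_function[OF compact_continuous_image[OF \<Psi> S] H e] by blast
  have "real_polynomial_function (\<lambda>w. Re (p w))" "real_polynomial_function (\<lambda>w. Im (p w))"
    using p(1)[unfolded polynomial_function_def, rule_format, OF bounded_linear_Re]
      p(1)[unfolded polynomial_function_def, rule_format, OF bounded_linear_Im]
    by (simp_all add: o_def)
  moreover have "(\<lambda>x. complex_of_real (r (\<Psi> x))) \<in> lin_combs B" if "real_polynomial_function r" for r
    using that by (intro real_polynomial_function_lin_combs one mult coord conj)
  ultimately have "(\<lambda>x. complex_of_real (Re (p (\<Psi> x))) + \<i> * complex_of_real (Im (p (\<Psi> x)))) \<in> lin_combs B"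
    by (intro lin_combs_plus lin_combs_scale)
  then have "(\<lambda>x. p (\<Psi> x)) \<in> lin_combs B" by (simp flip: complex_eq)
  then show ?thesis using p(2) H_eq by force
qed

section \<open>Integrals over the unit cube\<close>

text \<open>The shifted cube loses a slab of thickness \<open>s\<close> at the lower face and gains one at the upper face. The
  two slabs are one period apart, so \<open>g\<close> has the same integral over both.\<close>

lemma integral_unit_cube_shift:
  fixes g :: "real^'n \<Rightarrow> 'b::euclidean_space"
  assumes g: "continuous_on UNIV g" and per: "\<And>x. g (x + axis j 1) = g x"
    and s: "0 \<le> s" "s \<le> 1"
  shows "integral (cbox 0 1) (\<lambda>x. g (x + s *\<^sub>R axis j 1)) = integral (cbox 0 1) g"
proof -
  define k where "k = (axis j 1 :: real^'n)"
  have kB: "k \<in> Basis" by (simp add: k_def)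
  have k: "k $ i = (if i = j then 1 else 0)" for i by (simp add: k_def axis_def)
  have xk: "x \<bullet> k = x $ j" for x by (simp add: k_def inner_axis)
  have int: "g integrable_on cbox a b" for a b
    by (intro integrable_continuous continuous_on_subset[OF g]) auto
  have at_j: "(\<forall>i. P i) \<and> Q \<longleftrightarrow> (\<forall>i. P i \<and> (i = j \<longrightarrow> Q))" for P and Q
    by auto
  have box: "cbox (s *\<^sub>R k) (1 + s *\<^sub>R k) \<inter> {x. x \<bullet> k \<le> 1} = cbox (s *\<^sub>R k) 1"
    "cbox (s *\<^sub>R k) (1 + s *\<^sub>R k) \<inter> {x. 1 \<le> x \<bullet> k} = cbox k (1 + s *\<^sub>R k)"
    "cbox 0 1 \<inter> {x. x \<bullet> k \<le> s} = cbox 0 (1 + s *\<^sub>R k - k)"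
    "cbox 0 1 \<inter> {x. s \<le> x \<bullet> k} = cbox (s *\<^sub>R k) 1"
    unfolding set_eq_iff Int_iff mem_Collect_eq mem_box_cart xk at_j
    by (intro allI iff_allI; use s in \<open>auto simp: k\<close>)+
  have "integral (cbox 0 1) (\<lambda>x. g (x + s *\<^sub>R k)) = integral (cbox (s *\<^sub>R k) (1 + s *\<^sub>R k)) g"
    using integral_shift_cbox[of "s *\<^sub>R k" "s *\<^sub>R k" "1 + s *\<^sub>R k" g] by simp
  also have "\<dots> = integral (cbox (s *\<^sub>R k) 1) g + integral (cbox k (1 + s *\<^sub>R k)) g"
    using integral_split[OF int kB, of "s *\<^sub>R k" "1 + s *\<^sub>R k" 1] by (simp add: box)
  also have "integral (cbox k (1 + s *\<^sub>R k)) g = integral (cbox 0 (1 + s *\<^sub>R k - k)) g"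
    using integral_shift_cbox[of k k "1 + s *\<^sub>R k" g] per by (simp add: k_def)
  also have "integral (cbox (s *\<^sub>R k) 1) g + integral (cbox 0 (1 + s *\<^sub>R k - k)) g = integral (cbox 0 1) g"
    using integral_split[OF int kB, of 0 1 s] by (simp add: box)
  finally show ?thesis by (simp add: k_def)
qed

text \<open>A shift by half of the period \<open>1 / \<bar>m\<bar>\<close> multiplies \<open>g\<close> by \<open>-1\<close> and preserves the integral.\<close>

lemma integral_unit_cube_eq_0:
  fixes g :: "real^'n \<Rightarrow> complex" and m :: int
  assumes g: "continuous_on UNIV g" and m: "m \<noteq> 0"
    and shift: "\<And>x t. g (x + t *\<^sub>R axis j 1) = exp (2 * of_real pi * \<i> * of_real (of_int m * t)) * g x"
  shows "integral (cbox 0 1) g = 0"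
proof -
  define s where "s = 1 / (2 * \<bar>real_of_int m\<bar>)"
  have "1 \<le> \<bar>real_of_int m\<bar>" using m by linarith
  then have s: "0 \<le> s" "s \<le> 1" by (auto simp: s_def divide_le_eq)
  have "exp (2 * of_real pi * \<i> * of_int m) = (1::complex)"
    using exp_integer_2pi[of "of_int m"] by (simp add: mult_ac)
  then have "g (x + axis j 1) = g x" for x
    using shift[of x 1] by simp
  then have "integral (cbox 0 1) g = integral (cbox 0 1) (\<lambda>x. g (x + s *\<^sub>R axis j 1))"
    using integral_unit_cube_shift[OF g _ s] by simp
  also have "\<dots> = integral (cbox 0 1) (\<lambda>x. - g x)"
  proof -
    define \<theta> where "\<theta> = 2 * (of_int m * s)"
    have "\<theta> = 1 \<or> \<theta> = -1"
      using m by (auto simp: \<theta>_def s_def abs_if field_simps)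
    moreover have "2 * of_real pi * \<i> * of_real (of_int m * s) = \<i> * of_real (pi * \<theta>)"
      by (simp add: \<theta>_def)
    ultimately have "exp (2 * of_real pi * \<i> * of_real (of_int m * s)) = (-1::complex)"
      by (elim disjE) (simp_all only:, simp_all add: exp_minus)
    then show ?thesis by (simp only: shift) simp
  qed
  also have "\<dots> = - integral (cbox 0 1) g" by simp
  finally show ?thesis by (simp add: equal_neg_zero)
qed

section \<open>Orthonormal bases of exponentials\<close>

text \<open>The members of \<^const>\<open>exponential_system\<close>, in any dimension and with a name for each frequency.\<close>

definition phase_exp :: "('a \<Rightarrow> real^'m) \<Rightarrow> int^'m \<Rightarrow> 'a \<Rightarrow> complex" where
  "phase_exp \<phi> k x = exp (2 * of_real pi * \<i> * of_real ((\<chi> i. of_int (k $ i)) \<bullet> \<phi> x))"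

lemma exponential_system_eq: "exponential_system \<phi> = range (phase_exp \<phi>)"
  by (auto simp: exponential_system_def phase_exp_def fun_eq_iff image_iff)

lemma phase_exp_add: "phase_exp \<phi> (k + l) x = phase_exp \<phi> k x * phase_exp \<phi> l x"
  by (simp add: phase_exp_def inner_vec_def sum.distrib distrib_left distrib_right flip: exp_add)

lemma phase_exp_0: "phase_exp \<phi> 0 x = 1"
  by (simp add: phase_exp_def inner_vec_def)

lemma cnj_phase_exp: "cnj (phase_exp \<phi> k x) = phase_exp \<phi> (- k) x"
  by (simp add: phase_exp_def inner_vec_def exp_cnj sum_negf)

lemma phase_exp_axis: "phase_exp \<phi> (axis j 1) x = exp (2 * of_real pi * \<i> * of_real (\<phi> x $ j))"
proof -
  have "(\<chi> i. of_int (axis j 1 $ i)) = (axis j 1 :: real^'b)"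
    by (simp add: vec_eq_iff axis_def)
  then show ?thesis by (simp add: phase_exp_def inner_axis')
qed

lemma continuous_on_phase_exp: "continuous_on S \<phi> \<Longrightarrow> continuous_on S (phase_exp \<phi> k)"
  unfolding phase_exp_def by (intro continuous_intros)

lemma exp_2pi_eq_imp_diff_Ints:
  assumes "exp (2 * of_real pi * \<i> * of_real a) = exp (2 * of_real pi * \<i> * of_real b)"
  shows "a - b \<in> \<int>"
proof -
  obtain n :: int where
    "2 * of_real pi * \<i> * of_real a = 2 * of_real pi * \<i> * of_real b + of_real (real_of_int (2 * n) * pi) * \<i>"
    using assms unfolding exp_eq by blast
  then have "pi * a = pi * (b + of_int n)"
    by (simp add: complex_eq_iff algebra_simps)
  then have "a - b = of_int n" by simp
  then show ?thesis by simp
qed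

text \<open>The map \<open>\<Psi>\<close> with components \<open>exp (2 * pi * \<i> * \<phi>\<^sub>j)\<close> identifies two points exactly when their images
  under \<open>\<phi>\<close> differ by an integer vector. By the hypothesis on \<open>\<phi>\<close> this happens, for distinct points,
  only outside the open box, so a function vanishing there respects the fibres of \<open>\<Psi>\<close> and is
  uniformly approximated by combinations of exponentials.\<close>

lemma L2_approximable_phase_exp:
  fixes \<phi> :: "'a::euclidean_space \<Rightarrow> real^'m"
  assumes \<phi>: "continuous_on (cbox a b) \<phi>"
    and inj: "\<And>x y. x \<in> cbox a b \<Longrightarrow> y \<in> cbox a b \<Longrightarrow> (\<And>j. \<phi> x $ j - \<phi> y $ j \<in> \<int>) \<Longrightarrow>
        x = y \<or> (x \<notin> box a b \<and> y \<notin> box a b)"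
    and f: "f \<in> L2_functions (lebesgue_on (cbox a b))"
  shows "L2_approximable (lebesgue_on (cbox a b)) (lin_combs (range (phase_exp \<phi>))) f"
proof -
  let ?B = "range (phase_exp \<phi>)"
  define \<Psi> :: "'a \<Rightarrow> complex^'m" where "\<Psi> x = (\<chi> j. phase_exp \<phi> (axis j 1) x)" for x
  have cont: "continuous_on (cbox a b) u" if "u \<in> lin_combs ?B" for u
    by (rule continuous_on_lin_combs[OF _ that]) (auto intro: continuous_on_phase_exp \<phi>)
  then have A: "lin_combs ?B \<subseteq> L2_functions (lebesgue_on (cbox a b))"
    using continuous_imp_L2_functions by blast
  show ?thesis
  proof (rule L2_approximable_cbox[OF A _ f], rule L2_approximable_uniform[OF A])
    fix h :: "'a \<Rightarrow> complex" and e :: real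
    assume h: "continuous_on UNIV h" and h0: "\<And>x. x \<notin> box a b \<Longrightarrow> h x = 0"
    show hc: "continuous_on (cbox a b) h" using h continuous_on_subset by blast
    assume "0 < e"
    then show "\<exists>u\<in>lin_combs ?B. \<forall>x\<in>cbox a b. cmod (h x - u x) < e"
    proof (rule Stone_Weierstrass_lin_combs[where \<Psi> = \<Psi>, rotated -1])
      have "(\<lambda>_. 1) = phase_exp \<phi> 0"
        by (simp add: fun_eq_iff phase_exp_0)
      then show "(\<lambda>_. 1) \<in> ?B" by blast
      show "(\<lambda>x. g x * h x) \<in> ?B" if "g \<in> ?B" "h \<in> ?B" for g h
        using that by (auto simp flip: phase_exp_add[abs_def])
      show "(\<lambda>x. \<Psi> x $ j) \<in> ?B" for j
        by (simp add: \<Psi>_def)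
      show "(\<lambda>x. cnj (\<Psi> x $ j)) \<in> ?B" for j
        by (simp add: \<Psi>_def cnj_phase_exp)
      show "continuous_on (cbox a b) \<Psi>"
        unfolding \<Psi>_def by (intro continuous_on_vec_lambda continuous_on_phase_exp \<phi>)
      show "h x = h y" if "x \<in> cbox a b" "y \<in> cbox a b" "\<Psi> x = \<Psi> y" for x y
      proof -
        have "\<phi> x $ j - \<phi> y $ j \<in> \<int>" for j
        proof (rule exp_2pi_eq_imp_diff_Ints)
          have "\<Psi> x $ j = \<Psi> y $ j" using that by simp
          then show "exp (2 * of_real pi * \<i> * of_real (\<phi> x $ j)) = exp (2 * of_real pi * \<i> * of_real (\<phi> y $ j))"
            by (simp add: \<Psi>_def phase_exp_axis)
        qed
        then show ?thesis using inj[of x y] that h0 by auto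
      qed
    qed (use hc in auto)
  qed
qed

text \<open>The product of one exponential with the conjugate of another is again an exponential, so
  orthogonality only asks that the exponentials of nonzero frequency have integral zero.
  Different frequencies then also give different functions, since the frequency-zero exponential has
  integral 1.\<close>

lemma orthonormal_basis_L2_exponential_system:
  fixes \<phi> :: "real^2 \<Rightarrow> real^2"
  assumes \<phi>: "continuous_on UNIV \<phi>"
    and inj: "\<And>x y. x \<in> cbox 0 1 \<Longrightarrow> y \<in> cbox 0 1 \<Longrightarrow> (\<And>j. \<phi> x $ j - \<phi> y $ j \<in> \<int>) \<Longrightarrow>
        x = y \<or> (x \<notin> box 0 1 \<and> y \<notin> box 0 1)"
    and orth: "\<And>k. k \<noteq> 0 \<Longrightarrow> integral (cbox 0 1) (phase_exp \<phi> k) = 0"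
  shows "orthonormal_basis_L2 (lebesgue_on (cbox 0 1)) (exponential_system \<phi>)"
proof -
  let ?M = "lebesgue_on (cbox 0 1 :: (real^2) set)"
  have cont: "continuous_on S (phase_exp \<phi> k)" for S k
    by (intro continuous_on_phase_exp continuous_on_subset[OF \<phi>]) simp
  have "range (phase_exp \<phi>) \<subseteq> L2_functions ?M"
    using continuous_imp_L2_functions[OF cont] by blast
  moreover have inner: "L2_inner ?M (phase_exp \<phi> k) (phase_exp \<phi> l) = (if phase_exp \<phi> k = phase_exp \<phi> l then 1 else 0)"
    for k l
  proof -
    have "L2_inner ?M (phase_exp \<phi> k) (phase_exp \<phi> l) = (LINT x|?M. phase_exp \<phi> (k - l) x)"
      unfolding L2_inner_def cnj_phase_exp phase_exp_add[symmetric] by simp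
    also have "\<dots> = integral (cbox 0 1) (phase_exp \<phi> (k - l))"
      by (intro lebesgue_integral_eq_integral continuous_imp_integrable cont) auto
    finally have eq: "L2_inner ?M (phase_exp \<phi> k) (phase_exp \<phi> l) = integral (cbox 0 1) (phase_exp \<phi> (k - l))" .
    show ?thesis
    proof (cases "k = l")
      case True
      have "measure lborel (cbox 0 1 :: (real^2) set) = 1"
        by (subst content_cbox_cart) (auto simp: interval_ne_empty_cart)
      then show ?thesis
        using True eq by (simp add: phase_exp_0[abs_def])
    next
      case False
      then have 0: "L2_inner ?M (phase_exp \<phi> k) (phase_exp \<phi> l) = 0"
        using eq orth[of "k - l"] by simp
      have "phase_exp \<phi> k \<noteq> phase_exp \<phi> l"
      proof
        assume "phase_exp \<phi> k = phase_exp \<phi> l"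
        then have "phase_exp \<phi> (k - l) x = 1" for x
          using phase_exp_add[of \<phi> "k - l" l x] by (simp add: phase_exp_def)
        then have "integral (cbox 0 1) (phase_exp \<phi> (k - l)) = integral (cbox 0 (1::real^2)) (\<lambda>_. 1)"
          by (intro integral_cong)
        also have "\<dots> = 1"
          by (simp add: content_cbox_cart interval_ne_empty_cart)
        finally show False using orth[of "k - l"] False by simp
      qed
      then show ?thesis using 0 by simp
    qed
  qed
  moreover have "\<exists>S c. finite S \<and> S \<subseteq> range (phase_exp \<phi>) \<and>
        L2_norm_fun ?M (\<lambda>x. f x - (\<Sum>g\<in>S. c g * g x)) < \<epsilon>"
    if f: "f \<in> L2_functions ?M" and \<epsilon>: "0 < \<epsilon>" for f \<epsilon>
  proof -
    have "L2_approximable ?M (lin_combs (range (phase_exp \<phi>))) f"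
      by (rule L2_approximable_phase_exp[OF continuous_on_subset[OF \<phi>] inj f]) auto
    then obtain u where u: "u \<in> lin_combs (range (phase_exp \<phi>))"
        "(LINT x|?M. (cmod (f x - u x))\<^sup>2) < \<epsilon>\<^sup>2"
      unfolding L2_approximable_def using \<epsilon> by (meson zero_less_power)
    then have "L2_norm_fun ?M (\<lambda>x. f x - u x) < \<epsilon>"
      unfolding L2_norm_fun_def using \<epsilon> by (intro real_less_lsqrt) auto
    then show ?thesis using lin_combs_imp_sum[OF u(1)] by blast
  qed
  ultimately show ?thesis
    unfolding orthonormal_basis_L2_def exponential_system_eq by auto
qed

lemma continuous_on_vector_2:
  assumes "continuous_on S f" "continuous_on S g"
  shows "continuous_on S (\<lambda>x. vector [f x, g x] :: real^2)"
proof -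
  have "(\<lambda>x. vector [f x, g x] :: real^2) = (\<lambda>x. f x *\<^sub>R axis 1 1 + g x *\<^sub>R axis 2 1)"
    by (simp add: fun_eq_iff vec_eq_iff forall_2 axis_def)
  then show ?thesis using assms by (simp only:) (intro continuous_intros)
qed

lemma diff_Ints_unit_interval:
  fixes a b :: real
  assumes "a - b \<in> \<int>" "0 \<le> a" "a \<le> 1" "0 \<le> b" "b \<le> 1"
  shows "a = b \<or> (a \<in> {0, 1} \<and> b \<in> {0, 1})"
proof -
  obtain n :: int where n: "a - b = of_int n" using assms(1) by (elim Ints_cases)
  then have "real_of_int n \<le> 1" "-1 \<le> real_of_int n" using assms by linarith+
  then have "n = 0 \<or> n = 1 \<or> n = -1" by linarith
  then show ?thesis using n assms by auto
qed

text \<open>Modulo integer vectors, a shear is injective on the open square: equality of the second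
  coordinates cancels the terms \<open>f (x $ 2)\<close>. Increasing the first coordinate by \<open>t\<close> adds \<open>k $ 1 * t\<close> to the
  phase of the exponential of frequency \<open>k\<close>. If \<open>k $ 1 = 0\<close>, the term \<open>f\<close> drops out of the phase, and
  increasing the second coordinate by \<open>t\<close> adds \<open>k $ 2 * t\<close>.\<close>

lemma orthonormal_basis_L2_shear:
  fixes f :: "real \<Rightarrow> real"
  assumes f: "continuous_on UNIV f"
  shows "orthonormal_basis_L2 (lebesgue_on (cbox 0 1))
    (exponential_system (\<lambda>x. vector [x $ 1 + f (x $ 2), x $ 2 + c]))"
    (is "orthonormal_basis_L2 _ (exponential_system ?\<phi>)")
proof (rule orthonormal_basis_L2_exponential_system)
  show cont: "continuous_on UNIV ?\<phi>"
    by (intro continuous_on_vector_2 continuous_intros continuous_on_compose2[OF f]) auto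
  show "x = y \<or> (x \<notin> box 0 1 \<and> y \<notin> box 0 1)"
    if "x \<in> cbox 0 1" "y \<in> cbox 0 1" and int: "\<And>j. ?\<phi> x $ j - ?\<phi> y $ j \<in> \<int>" for x y
  proof -
    have x: "0 \<le> x $ j" "x $ j \<le> 1" and y: "0 \<le> y $ j" "y $ j \<le> 1" for j
      using that(1,2) by (simp_all add: mem_box_cart)
    show ?thesis
    proof (cases "x $ 2 = y $ 2")
      case True
      then have "x $ 1 - y $ 1 \<in> \<int>" using int[of 1] by simp
      then have "x $ 1 = y $ 1 \<or> (x $ 1 \<in> {0, 1} \<and> y $ 1 \<in> {0, 1})"
        using x y by (rule diff_Ints_unit_interval)
      then show ?thesis
        using True by (auto simp: vec_eq_iff forall_2 mem_box_cart)
    next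
      case False
      have "x $ 2 - y $ 2 \<in> \<int>" using int[of 2] by simp
      then have "x $ 2 = y $ 2 \<or> (x $ 2 \<in> {0, 1} \<and> y $ 2 \<in> {0, 1})"
        using x y by (rule diff_Ints_unit_interval)
      then show ?thesis
        using False by (auto simp: forall_2 mem_box_cart)
    qed
  qed
  show "integral (cbox 0 1) (phase_exp ?\<phi> k) = 0" if "k \<noteq> 0" for k
  proof (cases "k $ 1 = 0")
    case False
    show ?thesis
    proof (rule integral_unit_cube_eq_0[OF continuous_on_phase_exp[OF cont] False])
      show "phase_exp ?\<phi> k (x + t *\<^sub>R axis 1 1) =
          exp (2 * of_real pi * \<i> * of_real (of_int (k $ 1) * t)) * phase_exp ?\<phi> k x" for x t
        by (simp add: phase_exp_def inner_vec_def sum_2 axis_def algebra_simps flip: exp_add)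
    qed
  next
    case True
    with that have k2: "k $ 2 \<noteq> 0" by (auto simp: vec_eq_iff forall_2)
    show ?thesis
    proof (rule integral_unit_cube_eq_0[OF continuous_on_phase_exp[OF cont] k2])
      show "phase_exp ?\<phi> k (x + t *\<^sub>R axis 2 1) =
          exp (2 * of_real pi * \<i> * of_real (of_int (k $ 2) * t)) * phase_exp ?\<phi> k x" for x t
        using True
        by (simp add: phase_exp_def inner_vec_def sum_2 axis_def algebra_simps flip: exp_add)
    qed
  qed
qed

section \<open>Maps with triangular Jacobian of determinant one\<close>

lemma vector_add_axis:
  "vector [a, b] + t *\<^sub>R axis 1 1 = (vector [a + t, b] :: real^2)"
  "vector [a, b] + t *\<^sub>R axis 2 1 = (vector [a, b + t] :: real^2)"
  by (simp_all add: vec_eq_iff forall_2 axis_def)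

lemma vector_nth_eq: "vector [x $ 1, x $ 2] = (x :: real^2)"
  by (simp add: vec_eq_iff forall_2)

lemma has_field_derivative_partial_deriv:
  assumes "continuously_partial_diff j g"
  shows "((\<lambda>t. g (x + t *\<^sub>R axis j 1)) has_field_derivative partial_deriv j g (x + s *\<^sub>R axis j 1)) (at s)"
proof -
  have "((\<lambda>t. g ((x + s *\<^sub>R axis j 1) + t *\<^sub>R axis j 1)) has_field_derivative
      partial_deriv j g (x + s *\<^sub>R axis j 1)) (at 0)"
    using assms unfolding continuously_partial_diff_def partial_deriv_def
    by (simp add: DERIV_deriv_iff_field_differentiable)
  then show ?thesis
    using DERIV_shift[of "\<lambda>t. g (x + t *\<^sub>R axis j 1)" _ 0 s]
    by (simp add: scaleR_add_left algebra_simps)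
qed

lemma has_field_derivative_partial_deriv_2:
  fixes g :: "real^2 \<Rightarrow> real"
  shows "continuously_partial_diff 1 g \<Longrightarrow>
      ((\<lambda>t. g (vector [t, b])) has_field_derivative partial_deriv 1 g (vector [s, b])) (at s)"
    and "continuously_partial_diff 2 g \<Longrightarrow>
      ((\<lambda>t. g (vector [a, t])) has_field_derivative partial_deriv 2 g (vector [a, s])) (at s)"
  using has_field_derivative_partial_deriv[of 1 g "vector [0, b]" s]
    has_field_derivative_partial_deriv[of 2 g "vector [a, 0]" s]
  by (simp_all add: vector_add_axis)

lemma continuous_on_partial_deriv_vector:
  fixes g :: "real^2 \<Rightarrow> real"
  assumes "continuously_partial_diff 2 g"
  shows "continuous_on UNIV (\<lambda>t. partial_deriv 2 g (vector [a, t]))"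
  using assms unfolding continuously_partial_diff_def
  by (auto intro!: continuous_on_compose2[of UNIV "partial_deriv 2 g"] continuous_on_vector_2
      continuous_intros)

text \<open>The second component depends on \<open>x $ 2\<close> only, with derivative \<open>q\<close>. The determinant condition turns
  the derivative of the first component along \<open>x $ 1\<close> into \<open>1 / q (x $ 2)\<close>, which is constant in
  \<open>x $ 1\<close>, so the first component is affine in \<open>x $ 1\<close> with slope \<open>z = 1 / q\<close>.\<close>

lemma triangular_form_exists:
  fixes \<phi> :: "real^2 \<Rightarrow> real^2"
  assumes diff: "\<And>i j. continuously_partial_diff j (\<lambda>x. \<phi> x $ i)"
    and tri: "\<And>x. upper_triangular2 (jacobi_matrix \<phi> x)"
    and det1: "\<And>x. det (jacobi_matrix \<phi> x) = 1"
  shows "\<exists>z f K. triangular_form \<phi> z f K"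
proof -
  note D1 = has_field_derivative_partial_deriv_2(1)[OF diff]
  note D2 = has_field_derivative_partial_deriv_2(2)[OF diff]
  have zero: "partial_deriv 1 (\<lambda>x. \<phi> x $ 2) x = 0" for x
    using tri[of x] by (simp add: upper_triangular2_def jacobi_matrix_def)
  have prod1: "partial_deriv 1 (\<lambda>x. \<phi> x $ 1) x * partial_deriv 2 (\<lambda>x. \<phi> x $ 2) x = 1" for x
    using det1[of x] zero[of x] by (simp add: det_2 jacobi_matrix_def)
  define q where "q b = partial_deriv 2 (\<lambda>x. \<phi> x $ 2) (vector [0, b])" for b
  define f where "f b = \<phi> (vector [0, b]) $ 1" for b
  \<comment> \<open>The slope is written as a difference of values on the lines \<open>x $ 1 = 1\<close> and \<open>x $ 1 = 0\<close>. This
    shows that it is continuously differentiable, whereas \<open>1 / q\<close> with a continuous \<open>q\<close> does not.\<close>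
  define z where "z b = \<phi> (vector [1, b]) $ 1 - f b" for b
  have \<phi>2: "\<phi> (vector [a, b]) $ 2 = \<phi> (vector [0, b]) $ 2" for a b
    using D1[of b 2] by (intro DERIV_isconst_all[of "\<lambda>t. \<phi> (vector [t, b]) $ 2"]) (simp add: zero)
  have "partial_deriv 2 (\<lambda>x. \<phi> x $ 2) (vector [a, b]) = q b" for a b
    using D2[of a 2 b] D2[of 0 2 b] unfolding q_def \<phi>2[of a] by (rule DERIV_unique)
  then have p11: "partial_deriv 1 (\<lambda>x. \<phi> x $ 1) (vector [a, b]) * q b = 1" for a b
    using prod1[of "vector [a, b]"] by simp
  then have q0: "q b \<noteq> 0" for b by (metis mult_zero_right zero_neq_one)
  have p11': "partial_deriv 1 (\<lambda>x. \<phi> x $ 1) (vector [a, b]) = 1 / q b" for a b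
    using p11[of a b] q0 by (simp add: eq_divide_eq)
  have aff: "\<phi> (vector [a, b]) $ 1 = a / q b + f b" for a b
  proof -
    have "((\<lambda>t. \<phi> (vector [t, b]) $ 1 - t / q b) has_field_derivative 0) (at t)" for t
      using D1[of b 1 t] by (auto intro!: derivative_eq_intros simp: p11' q0)
    then have "\<phi> (vector [a, b]) $ 1 - a / q b = \<phi> (vector [0, b]) $ 1 - 0 / q b"
      by (intro DERIV_isconst_all[of "\<lambda>t. \<phi> (vector [t, b]) $ 1 - t / q b"]) simp
    then show ?thesis by (simp add: f_def)
  qed
  have zq: "z b = 1 / q b" for b unfolding z_def aff by simp
  have C1: "(\<lambda>b. \<phi> (vector [a, b]) $ 1) C1_differentiable_on UNIV" for a
    unfolding C1_differentiable_on_def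
    using D2[of a 1] continuous_on_partial_deriv_vector[OF diff[of 2 1], of a]
    by (intro exI[of _ "\<lambda>s. partial_deriv 2 (\<lambda>x. \<phi> x $ 1) (vector [a, s])"])
      (simp add: has_real_derivative_iff_has_vector_derivative)
  have int: "(LBINT t=1..b. 1 / z t) = \<phi> (vector [0, b]) $ 2 - \<phi> (vector [0, 1]) $ 2" for b
  proof -
    have "(LBINT t=ereal 1..ereal b. q t) = \<phi> (vector [0, b]) $ 2 - \<phi> (vector [0, 1]) $ 2"
    proof (rule interval_integral_FTC_finite)
      show "continuous_on {min 1 b..max 1 b} q"
        unfolding q_def
        by (rule continuous_on_subset[OF continuous_on_partial_deriv_vector[OF diff]]) simp
      show "((\<lambda>b. \<phi> (vector [0, b]) $ 2) has_vector_derivative q x) (at x within {min 1 b..max 1 b})" for x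
      proof (rule has_vector_derivative_at_within)
        show "((\<lambda>b. \<phi> (vector [0, b]) $ 2) has_vector_derivative q x) (at x)"
          using D2[of 0 2 x] by (simp add: q_def has_real_derivative_iff_has_vector_derivative)
      qed
    qed
    then show ?thesis by (simp add: zq one_ereal_def)
  qed
  have \<phi>: "\<phi> x = vector [x $ 1 / q (x $ 2) + f (x $ 2), \<phi> (vector [0, x $ 2]) $ 2]" for x
    unfolding vec_eq_iff forall_2 vector_2
    using aff[of "x $ 1" "x $ 2"] \<phi>2[of "x $ 1" "x $ 2"] unfolding vector_nth_eq by (intro conjI)
  have "\<phi> x = vector [z (x $ 2) * x $ 1 + f (x $ 2),
      (LBINT t=1..x $ 2. 1 / z t) + \<phi> (vector [0, 1]) $ 2]" for x
    unfolding int by (subst \<phi>) (simp add: zq)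
  moreover have "f C1_differentiable_on UNIV" "z C1_differentiable_on UNIV"
    unfolding z_def[abs_def] f_def[abs_def] by (intro C1_differentiable_on_diff C1)+
  moreover have "z t \<noteq> 0" for t
    using q0 by (simp add: zq)
  ultimately have "triangular_form \<phi> z f (\<phi> (vector [0, 1]) $ 2)"
    unfolding triangular_form_def by blast
  then show ?thesis by blast
qed

theorem theorem6p4:
  fixes \<phi> :: "real^2 \<Rightarrow> real^2"
  assumes "\<And>i. continuous_mixed_partials (\<lambda>x. \<phi> x $ i)"
    and "\<And>x. upper_triangular2 (jacobi_matrix \<phi> x)"
    and "\<And>x. det (jacobi_matrix \<phi> x) = 1"
  shows "(\<exists>z f K. triangular_form \<phi> z f K) \<and>
    (\<forall>z f K. triangular_form \<phi> z f K \<and> z = (\<lambda>t. 1) \<longrightarrow>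
       (\<exists>l1. l1 C1_differentiable_on UNIV \<and>
          (\<forall>x. \<phi> x = vector [x $ 1 + l1 (x $ 2), x $ 2 + (K - 1)]) \<and>
          (K = 1 \<longrightarrow> (\<forall>x. \<phi> x = vector [x $ 1 + l1 (x $ 2), x $ 2]))) \<and>
       orthonormal_basis_L2 (lebesgue_on (cbox 0 1)) (exponential_system \<phi>))"
proof (intro conjI allI impI)
  show "\<exists>z f K. triangular_form \<phi> z f K"
    using assms by (intro triangular_form_exists) (auto simp: continuous_mixed_partials_def)
  fix z f K
  assume "triangular_form \<phi> z f K \<and> z = (\<lambda>t. 1)"
  then have tf: "triangular_form \<phi> (\<lambda>_. 1) f K" by auto
  then have f: "f C1_differentiable_on UNIV" by (simp add: triangular_form_def)
  have int: "(LBINT t=1..b. 1 / (1::real)) = b - 1" for b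
    using interval_integral_FTC_finite[of 1 b "\<lambda>_. 1" "\<lambda>t. t"]
    by (simp add: one_ereal_def)
  have \<phi>: "\<phi> x = vector [x $ 1 + f (x $ 2), x $ 2 + (K - 1)]" for x
  proof -
    have "\<phi> x = vector [1 * x $ 1 + f (x $ 2), (LBINT t=1..x $ 2. 1 / 1) + K]"
      using tf unfolding triangular_form_def by blast
    then show ?thesis unfolding int by (simp add: algebra_simps)
  qed
  then show "\<exists>l1. l1 C1_differentiable_on UNIV \<and>
          (\<forall>x. \<phi> x = vector [x $ 1 + l1 (x $ 2), x $ 2 + (K - 1)]) \<and>
          (K = 1 \<longrightarrow> (\<forall>x. \<phi> x = vector [x $ 1 + l1 (x $ 2), x $ 2]))"
    using f by (intro exI[of _ f]) simp
  show "orthonormal_basis_L2 (lebesgue_on (cbox 0 1)) (exponential_system \<phi>)"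
    unfolding ext[of \<phi>, OF \<phi>]
    by (intro orthonormal_basis_L2_shear C1_differentiable_imp_continuous_on f)
qed

end
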